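(* Assume there are sequences $\{\delta_n\in(0,1)\}$ and $\{p_n\in(0,1)\}$ such that for every sufficiently large $n$ and each $i\in[n]$ one of the following holds: (i) $P\{P(X_j>X_i\mid X_i)-P(X_j>X_i)\in[\delta_n,1],\ \forall j\in[n]\setminus\{i\}\}\ge p_n$; (ii) $P\{P(X_j>X_i\mid X_i)-P(X_j>X_i)\in[-1,-\delta_n],\ \forall j\in[n]\setminus\{i\}\}\ge p_n$; and assume $\delta_n^3p_n\gnsim n^{-1/3}(\log n)^2$. Assume there exist $\theta>0$ and an absolute constant $C>0$ such that for all distinct $i,j\in[n]$, $$|P(X_i>X_j)-\theta|\le Cn^{-1/6}\log n.$$ In addition, assume there exist $\eta^2>0$ and an absolute constant $C>0$ such that for all $1\le i\le n$ and all $1\le j,k\le n$ with $j\ne i$ and $k\ne i$, $$|E\{P(X_j>X_i\mid X_i)P(X_k>X_i\mid X_i)\}-\eta^2|\le Cn^{-1/3}(\log n)^2.$$ Assume $\eta^2\ne\theta^2$. Then, with $\sigma_n^2=\mathrm{Var}(U_n^{\rm AP})$, $$|\mathrm{Var}^*(\sigma_n^{-1}U_n^{\rm AP*})-\mathrm{Var}(\sigma_n^{-1}U_n^{\rm AP})|\stackrel{P}{\to}0 .$$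
   Context: For each $n$, $X_1,\dots,X_n$ (a triangular array $X_{n,1},\dots,X_{n,n}$) are independent real random variables, not necessarily identically distributed, with distributions absolutely continuous with respect to Lebesgue measure (and possibly changing with $n$). $[n]=\{1,\dots,n\}$, $\mathbf 1(\cdot)$ is the indicator function, and $$U_n^{\rm AP}=\frac{1}{n(n-1)}\sum_{i\ne j}\frac{n\mathbf 1(j<i)}{i-1}\mathbf 1(X_j>X_i),\qquad 0/0:=0 .$$ Given $X_1,\dots,X_n$, let $X_1^*,\dots,X_n^*$ be i.i.d. draws from the empirical distribution of $X_1,\dots,X_n$, and $U_n^{\rm AP*}=\frac{1}{n(n-1)}\sum_{i\ne j}\frac{n\mathbf 1(j<i)}{i-1}\mathbf 1(X_j^*>X_i^* )$; $\mathrm{Var}^*$ is the conditional variance given $X_1,\dots,X_n$. The constants $\theta,\eta^2,C$ do not depend on $n$. Order notation: $a_n\lesssim b_n$ (equivalently $b_n\gtrsim a_n$) means there is an absolute constant $C$ with $|a_n|\le C|b_n|$ for all sufficiently large $n$; $a_n\gnsim b_n$ means $a_n\gtrsim b_n$ holds but $a_n\lesssim b_n$ does not. *)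

theory Defs
  imports "HOL-Probability.Probability"
begin

(* The indices i, j range over 1..n.  For i = 1 every numerator is 0, so the
   convention 0/0 = 0 is the one of HOL. *)
definition U_AP :: "nat \<Rightarrow> (nat \<Rightarrow> real) \<Rightarrow> real" where
  "U_AP n x = 1 / (real n * (real n - 1)) *
     (\<Sum>i\<in>{1..n}. \<Sum>j\<in>{1..n} - {i}.
        real n * of_bool (j < i) / (real i - 1) * of_bool (x j > x i))"

definition cond_prob_given :: "'a measure \<Rightarrow> ('a \<Rightarrow> real) \<Rightarrow> 'a set \<Rightarrow> 'a \<Rightarrow> real" where
  "cond_prob_given M Z A = real_cond_exp M (vimage_algebra (space M) Z borel) (indicator A)"

(* X is one row of the array; the conditioning variable is the second index i.  Conditional
   probabilities are determined only up to null sets, via real_cond_exp. *)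
definition prob_gt :: "'a measure \<Rightarrow> (nat \<Rightarrow> 'a \<Rightarrow> real) \<Rightarrow> nat \<Rightarrow> nat \<Rightarrow> real" where
  "prob_gt M X j i = measure M {\<omega> \<in> space M. X j \<omega> > X i \<omega>}"

definition cond_prob_gt :: "'a measure \<Rightarrow> (nat \<Rightarrow> 'a \<Rightarrow> real) \<Rightarrow> nat \<Rightarrow> nat \<Rightarrow> 'a \<Rightarrow> real" where
  "cond_prob_gt M X j i = cond_prob_given M (X i) {\<omega> \<in> space M. X j \<omega> > X i \<omega>}"

definition empirical_pmf :: "nat \<Rightarrow> (nat \<Rightarrow> real) \<Rightarrow> real pmf" where
  "empirical_pmf n x = map_pmf x (pmf_of_set {1..n})"

(* Joint law of X*_1, ..., X*_n given the data x; coordinates outside 1..n are set to the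
   irrelevant value 0. *)
definition bootstrap_pmf :: "nat \<Rightarrow> (nat \<Rightarrow> real) \<Rightarrow> (nat \<Rightarrow> real) pmf" where
  "bootstrap_pmf n x = Pi_pmf {1..n} 0 (\<lambda>_. empirical_pmf n x)"

definition bootstrap_variance ::
    "nat \<Rightarrow> (nat \<Rightarrow> real) \<Rightarrow> ((nat \<Rightarrow> real) \<Rightarrow> real) \<Rightarrow> real" where
  "bootstrap_variance n x f = measure_pmf.variance (bootstrap_pmf n x) f"

(* The n-th variable may live on its own probability space M n. *)
definition conv_in_prob_zero :: "(nat \<Rightarrow> 'a measure) \<Rightarrow> (nat \<Rightarrow> 'a \<Rightarrow> real) \<Rightarrow> bool" where
  "conv_in_prob_zero M Z \<longleftrightarrow>
     (\<forall>\<epsilon>>0. (\<lambda>n. measure (M n) {\<omega> \<in> space (M n). \<bar>Z n \<omega>\<bar> > \<epsilon>}) \<longlonglongrightarrow> 0)"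

(* b \<in> O(a) reads "a is at least of order b"; the second conjunct excludes a being at most
   of order b. *)
definition strictly_gtrsim :: "(nat \<Rightarrow> real) \<Rightarrow> (nat \<Rightarrow> real) \<Rightarrow> bool" where
  "strictly_gtrsim a b \<longleftrightarrow> b \<in> O(a) \<and> a \<notin> O(b)"

end

theory Submission
  imports Defs "HOL-Real_Asymp.Real_Asymp"
begin

text \<open>
  The values of $\theta$ and $\eta^2$ are forced. Two values without a tie are ordered
  in exactly one way, so the probabilities of the two orders add up to $1$ and $\theta = 1/2$.
  Among three values without a tie exactly one is the strict minimum, so
  $\eta^2 = 1/3$; here independence turns the mixed moment of the conditional probabilities into
  the probability that \<open>X i\<close> lies below both \<open>X j\<close> and \<open>X k\<close>.

  To first order this determines every covariance of two comparisons $1(X_j > X_i)$ and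
  $1(X_l > X_k)$. It is $0$ when the pairs are disjoint; when they share one index it tends to
  $1/3 - 1/4 = 1/12$ if that index plays the same role in both pairs, and to
  $1/6 - 1/4 = -1/12$ otherwise. In all these cases the limit is one twelfth of the inner product
  of the vectors $e_i - e_j$ and $e_k - e_l$. Since $(n-1) U_n^{\rm AP}$ is the sum of the
  comparisons with $j < i$ weighted by $w_{ij} = 1/(i-1)$, its variance is
  $\frac{1}{12} \| \sum_{j<i} w_{ij} (e_i - e_j) \|^2$ up to errors. This squared norm is
  exactly $n - 1 + H_{n-1}$ (lemma \<open>energy_minus\<close>). The errors are governed by
  $\| \sum_{j<i} w_{ij} (e_i + e_j) \|^2 \le 5 (n - 1)$ (lemma \<open>energy_plus\<close>), and the diagonal
  terms only contribute $\sum_{j<i} w_{ij}^2 = H_{n-1}$. Thus $(n-1) {\rm Var}(U_n^{\rm AP}) \to 1/12$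
  (\<open>variance_U_AP_approx\<close>).

  The argument works for all independent variables whose pair and triple probabilities are nearly
  constant and whose ties are rare. This covers the data and equally a bootstrap sample, which
  is i.i.d. and in which two draws tie with probability $1/n$ when the data are distinct. The data are almost surely distinct, because their laws have no atoms. Hence
  $(n-1) {\rm Var}^*(U_n^{\rm AP*}) \to 1/12$ as well, with an error bound that does not depend on the
  data, and the ratio of the two variances tends to $1$.
\<close>

section \<open>Weighted pairs and their incidence vectors\<close>

definition ordered_pairs :: "nat \<Rightarrow> (nat \<times> nat) set" where
  "ordered_pairs n = (SIGMA i:{1..n}. {1..<i})"

definition weight :: "nat \<times> nat \<Rightarrow> real" where
  "weight q = 1 / (real (fst q) - 1)"

text \<open>The coordinates of the vector $e_i + c\, e_j$ attached to a pair $(i, j)$: the signed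
  ($c = -1$) or unsigned ($c = 1$) incidence vector of an edge.\<close>

definition incidence :: "real \<Rightarrow> nat \<Rightarrow> nat \<times> nat \<Rightarrow> real" where
  "incidence c k q = of_bool (fst q = k) + c * of_bool (snd q = k)"

definition load :: "real \<Rightarrow> nat \<Rightarrow> nat \<Rightarrow> real" where
  "load c n k = (\<Sum>q\<in>ordered_pairs n. weight q * incidence c k q)"

text \<open>The squared Euclidean norm of the load vector. It is a quadratic form in the weights, which
  is how it enters the variance.\<close>

definition energy :: "real \<Rightarrow> nat \<Rightarrow> real" where
  "energy c n = (\<Sum>k\<in>{1..n}. (load c n k)\<^sup>2)"

lemma finite_ordered_pairs [simp]: "finite (ordered_pairs n)"
  by (simp add: ordered_pairs_def)

lemma mem_ordered_pairs:
  "q \<in> ordered_pairs n \<longleftrightarrow> 1 \<le> snd q \<and> snd q < fst q \<and> fst q \<le> n"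
  by (cases q) (auto simp: ordered_pairs_def)

lemma weight_nonneg: "q \<in> ordered_pairs n \<Longrightarrow> weight q \<ge> 0"
  by (auto simp: mem_ordered_pairs weight_def)

lemma sum_ordered_pairs: "sum f (ordered_pairs n) = (\<Sum>i\<in>{1..n}. \<Sum>j\<in>{1..<i}. f (i, j))"
  by (simp add: ordered_pairs_def sum.Sigma split_def)

lemma sum_ordered_pairs_Suc:
  "sum f (ordered_pairs (Suc n)) = sum f (ordered_pairs n) + (\<Sum>j\<in>{1..n}. f (Suc n, j))"
  by (simp add: sum_ordered_pairs atLeastLessThanSuc_atLeastAtMost)

lemma U_AP_eq_sum_pairs:
  assumes "n \<ge> 2"
  shows "(real n - 1) * U_AP n x = (\<Sum>q\<in>ordered_pairs n. weight q * of_bool (x (snd q) > x (fst q)))"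
proof -
  have "(\<Sum>j\<in>{1..n} - {i}. real n * of_bool (j < i) / (real i - 1) * of_bool (x j > x i))
      = real n * (\<Sum>j\<in>{1..<i}. weight (i, j) * of_bool (x j > x i))" if "i \<in> {1..n}" for i
    unfolding sum_distrib_left using that
    by (intro sum.mono_neutral_cong_right) (auto simp: weight_def)
  then have "U_AP n x = 1 / (real n * (real n - 1)) *
      (\<Sum>i\<in>{1..n}. real n * (\<Sum>j\<in>{1..<i}. weight (i, j) * of_bool (x j > x i)))"
    unfolding U_AP_def by (intro arg_cong2[of _ _ _ _ "(*)"] sum.cong[OF refl] refl) blast
  then have "U_AP n x = 1 / (real n * (real n - 1)) *
      (real n * (\<Sum>q\<in>ordered_pairs n. weight q * of_bool (x (snd q) > x (fst q))))"
    by (simp add: sum_ordered_pairs sum_distrib_left)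
  then have "U_AP n x = (\<Sum>q\<in>ordered_pairs n. weight q * of_bool (x (snd q) > x (fst q))) / (real n - 1)"
    using assms by simp
  then show ?thesis
    using assms by simp
qed

text \<open>The pairs with larger index $n + 1$ all have weight $1/n$, and each $k \le n$ is the smaller
  index of exactly one of them.\<close>

lemma load_Suc:
  assumes "k \<in> {1..n}"
  shows "load c (Suc n) k = load c n k + c / real n"
proof -
  have "(\<Sum>j\<in>{1..n}. weight (Suc n, j) * incidence c k (Suc n, j))
      = (\<Sum>j\<in>{1..n}. if k = j then c / real n else 0)"
    using assms by (intro sum.cong) (auto simp: weight_def incidence_def)
  also have "\<dots> = c / real n"
    using assms by simp
  finally show ?thesis
    unfolding load_def by (simp add: sum_ordered_pairs_Suc)
qed

lemma load_last:
  assumes "n \<ge> 1"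
  shows "load c (Suc n) (Suc n) = 1"
proof -
  have "(\<Sum>q\<in>ordered_pairs n. weight q * incidence c (Suc n) q) = 0"
    by (intro sum.neutral) (auto simp: mem_ordered_pairs incidence_def)
  moreover have "(\<Sum>j\<in>{1..n}. weight (Suc n, j) * incidence c (Suc n) (Suc n, j)) = (\<Sum>j\<in>{1..n}. 1 / real n)"
    by (intro sum.cong) (auto simp: weight_def incidence_def)
  ultimately show ?thesis
    using assms unfolding load_def by (simp add: sum_ordered_pairs_Suc)
qed

lemma sum_load:
  assumes "n \<ge> 1"
  shows "(\<Sum>k\<in>{1..n}. load c n k) = (1 + c) * (real n - 1)"
  using assms
proof (induction n rule: nat_induct_at_least)
  case base
  then show ?case by (simp add: load_def sum_ordered_pairs)
next
  case (Suc n)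
  have "(\<Sum>k\<in>{1..Suc n}. load c (Suc n) k) = (\<Sum>k\<in>{1..n}. load c n k + c / real n) + 1"
    using Suc.hyps by (simp add: load_Suc load_last del: of_nat_Suc)
  also have "\<dots> = (1 + c) * (real n - 1) + c + 1"
    using Suc by (simp add: sum.distrib)
  finally show ?case by (simp add: algebra_simps)
qed

text \<open>Passing from $n$ to $n + 1$ shifts every coordinate of the load vector by the same amount
  $c/n$ and appends a $1$. Expanding the squares therefore only involves the sum of the
  coordinates, which is known.\<close>

lemma energy_Suc:
  assumes "n \<ge> 1"
  shows "energy c (Suc n) = energy c n + 2 * c * (1 + c) * (real n - 1) / real n + c\<^sup>2 / real n + 1"
proof -
  have "energy c (Suc n) = (\<Sum>k\<in>{1..n}. (load c n k + c / real n)\<^sup>2) + 1"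
    using assms by (simp add: energy_def load_Suc load_last)
  also have "(\<Sum>k\<in>{1..n}. (load c n k + c / real n)\<^sup>2)
      = (\<Sum>k\<in>{1..n}. (load c n k)\<^sup>2 + (2 * c / real n) * load c n k + (c / real n)\<^sup>2)"
    by (intro sum.cong) (auto simp: power2_sum)
  also have "\<dots> = energy c n + (2 * c / real n) * ((1 + c) * (real n - 1)) + real n * (c / real n)\<^sup>2"
    unfolding energy_def sum_load[OF assms, symmetric]
    by (simp add: sum.distrib sum_distrib_left)
  finally show ?thesis
    using assms by (simp add: power2_eq_square mult.assoc)
qed

lemma energy_1: "energy c 1 = 0"
  by (simp add: energy_def load_def sum_ordered_pairs)

text \<open>For $c = -1$ the coordinates sum to $0$, so the cross term vanishes and the recursion adds
  exactly $1 + 1/n$.\<close>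

lemma energy_minus:
  assumes "n \<ge> 1"
  shows "energy (- 1) n = real n - 1 + harm (n - 1)"
  using assms
proof (induction n rule: nat_induct_at_least)
  case base
  then show ?case using energy_1 by (simp add: harm_def)
next
  case (Suc n)
  then obtain m where "n = Suc m" by (cases n) auto
  with Suc show ?case by (simp add: energy_Suc harm_Suc field_simps)
qed

lemma energy_plus:
  assumes "n \<ge> 1"
  shows "energy 1 n \<le> 5 * (real n - 1)"
  using assms
proof (induction n rule: nat_induct_at_least)
  case base
  then show ?case using energy_1 by simp
next
  case (Suc n)
  have "energy 1 (Suc n) = energy 1 n + (4 * (real n - 1) / real n + 1 / real n) + 1"
    using Suc.hyps by (simp add: energy_Suc)
  moreover have "4 * (real n - 1) / real n + 1 / real n \<le> 4"
    using Suc.hyps by (simp add: field_simps)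
  ultimately show ?case using Suc.IH by simp
qed

lemma sum_weight_square:
  assumes "n \<ge> 1"
  shows "(\<Sum>q\<in>ordered_pairs n. (weight q)\<^sup>2) = harm (n - 1)"
  using assms
proof (induction n rule: nat_induct_at_least)
  case base
  then show ?case by (simp add: sum_ordered_pairs harm_def)
next
  case (Suc n)
  then obtain m where m: "n = Suc m" by (cases n) auto
  have "(\<Sum>j\<in>{1..n}. (weight (Suc n, j))\<^sup>2) = (\<Sum>j\<in>{1..n}. (1 / real n)\<^sup>2)"
    by (simp add: weight_def)
  also have "\<dots> = inverse (real n)"
    using Suc.hyps by (simp add: power2_eq_square field_simps)
  finally show ?case
    using Suc.IH m by (simp add: sum_ordered_pairs_Suc harm_Suc)
qed

text \<open>The inner product of $e_i + c\, e_j$ and $e_k + c\, e_l$. For $c = 1$ it bounds the indicator that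
  two pairs share an index; for $c = -1$ it records the sign with which they do.\<close>

definition overlap :: "real \<Rightarrow> nat \<times> nat \<Rightarrow> nat \<times> nat \<Rightarrow> real" where
  "overlap c q r = of_bool (fst q = fst r) + c * of_bool (fst q = snd r)
     + c * of_bool (snd q = fst r) + c\<^sup>2 * of_bool (snd q = snd r)"

lemma overlap_eq_sum:
  assumes "q \<in> ordered_pairs n" "r \<in> ordered_pairs n"
  shows "overlap c q r = (\<Sum>k\<in>{1..n}. incidence c k q * incidence c k r)"
proof -
  have "(\<Sum>k\<in>{1..n}. incidence c k q * incidence c k r)
     = (\<Sum>k\<in>{1..n}. (if fst q = k then incidence c k r else 0) + c * (if snd q = k then incidence c k r else 0))"
    by (intro sum.cong) (auto simp: incidence_def[of _ _ q] algebra_simps)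
  also have "\<dots> = incidence c (fst q) r + c * incidence c (snd q) r"
    using assms by (auto simp: sum.distrib sum_distrib_left[symmetric] mem_ordered_pairs)
  also have "\<dots> = overlap c q r"
    by (auto simp: incidence_def overlap_def power2_eq_square algebra_simps)
  finally show ?thesis ..
qed

lemma sum_weight_overlap:
  "(\<Sum>q\<in>ordered_pairs n. \<Sum>r\<in>ordered_pairs n. weight q * weight r * overlap c q r) = energy c n"
proof -
  have "(\<Sum>q\<in>ordered_pairs n. \<Sum>r\<in>ordered_pairs n. weight q * weight r * overlap c q r)
     = (\<Sum>q\<in>ordered_pairs n. \<Sum>r\<in>ordered_pairs n. \<Sum>k\<in>{1..n}. 
          (weight q * incidence c k q) * (weight r * incidence c k r))"
    by (intro sum.cong) (simp_all add: overlap_eq_sum sum_distrib_left mult_ac)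
  also have "\<dots> = (\<Sum>q\<in>ordered_pairs n. \<Sum>k\<in>{1..n}. \<Sum>r\<in>ordered_pairs n.
          (weight q * incidence c k q) * (weight r * incidence c k r))"
    by (intro sum.cong refl sum.swap)
  also have "\<dots> = (\<Sum>k\<in>{1..n}. \<Sum>q\<in>ordered_pairs n. \<Sum>r\<in>ordered_pairs n.
          (weight q * incidence c k q) * (weight r * incidence c k r))"
    by (rule sum.swap)
  also have "\<dots> = energy c n"
    by (simp add: energy_def load_def sum_product power2_eq_square)
  finally show ?thesis .
qed

section \<open>Variances and Fubini for independent variables\<close>

text \<open>The variance is the quadratic form of the covariance matrix of the events.\<close>

lemma (in prob_space) variance_sum_indicators:
  fixes w :: "'b \<Rightarrow> real"
  assumes "finite D" and A: "\<And>q. q \<in> D \<Longrightarrow> A q \<in> events"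
  shows "variance (\<lambda>\<omega>. \<Sum>q\<in>D. w q * indicator (A q) \<omega>)
      = (\<Sum>q\<in>D. \<Sum>r\<in>D. w q * w r * (prob (A q \<inter> A r) - prob (A q) * prob (A r)))"
proof -
  have int: "integrable M (\<lambda>\<omega>. w q * indicator (A q) \<omega> * (w r * indicator (A r) \<omega>))"
    if "q \<in> D" "r \<in> D" for q r
  proof -
    have "integrable M (\<lambda>\<omega>. w q * w r * indicator (A q \<inter> A r) \<omega>)"
      using A that by (intro integrable_mult_right integrable_real_indicator) (auto simp: emeasure_eq_measure)
    then show ?thesis by (simp add: indicator_inter_arith mult_ac)
  qed
  have sq: "(\<Sum>q\<in>D. w q * indicator (A q) \<omega>)\<^sup>2 =
     (\<Sum>q\<in>D. \<Sum>r\<in>D. w q * indicator (A q) \<omega> * (w r * indicator (A r) \<omega>))" for \<omega>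
    by (simp add: power2_eq_square sum_product)
  have E: "expectation (\<lambda>\<omega>. w q * indicator (A q) \<omega>) = w q * prob (A q)" if "q \<in> D" for q
    using A[OF that] by simp
  have E2: "expectation (\<lambda>\<omega>. w q * indicator (A q) \<omega> * (w r * indicator (A r) \<omega>)) = w q * w r * prob (A q \<inter> A r)"
    if "q \<in> D" "r \<in> D" for q r
  proof -
    have "expectation (\<lambda>\<omega>. w q * w r * indicator (A q \<inter> A r) \<omega>) = w q * w r * prob (A q \<inter> A r)"
      using A that by simp
    then show ?thesis by (simp add: indicator_inter_arith mult_ac)
  qed
  have i1: "integrable M (\<lambda>\<omega>. w q * indicator (A q) \<omega>)" if "q \<in> D" for q
    using A[OF that] by (intro integrable_mult_right integrable_real_indicator) (auto simp: emeasure_eq_measure)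
  have "variance (\<lambda>\<omega>. \<Sum>q\<in>D. w q * indicator (A q) \<omega>)
      = (\<Sum>q\<in>D. \<Sum>r\<in>D. w q * w r * prob (A q \<inter> A r)) - (\<Sum>q\<in>D. w q * prob (A q))\<^sup>2"
  proof (subst variance_eq)
    show "integrable M (\<lambda>\<omega>. \<Sum>q\<in>D. w q * indicator (A q) \<omega>)"
      by (intro Bochner_Integration.integrable_sum i1)
    show "integrable M (\<lambda>\<omega>. (\<Sum>q\<in>D. w q * indicator (A q) \<omega>)\<^sup>2)"
      unfolding sq by (intro Bochner_Integration.integrable_sum int)
    have "expectation (\<lambda>\<omega>. \<Sum>q\<in>D. w q * indicator (A q) \<omega>) = (\<Sum>q\<in>D. w q * prob (A q))"
      by (subst Bochner_Integration.integral_sum) (auto simp only: i1 E intro!: sum.cong)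
    moreover have "expectation (\<lambda>\<omega>. (\<Sum>q\<in>D. w q * indicator (A q) \<omega>)\<^sup>2)
        = (\<Sum>q\<in>D. \<Sum>r\<in>D. w q * w r * prob (A q \<inter> A r))"
      unfolding sq
      by (subst Bochner_Integration.integral_sum, intro Bochner_Integration.integrable_sum int, assumption+,
          intro sum.cong refl, subst Bochner_Integration.integral_sum) (auto simp only: int E2 intro!: sum.cong)
    ultimately show "expectation (\<lambda>\<omega>. (\<Sum>q\<in>D. w q * indicator (A q) \<omega>)\<^sup>2)
        - (expectation (\<lambda>\<omega>. \<Sum>q\<in>D. w q * indicator (A q) \<omega>))\<^sup>2
        = (\<Sum>q\<in>D. \<Sum>r\<in>D. w q * w r * prob (A q \<inter> A r)) - (\<Sum>q\<in>D. w q * prob (A q))\<^sup>2"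
      by simp
  qed
  also have "\<dots> = (\<Sum>q\<in>D. \<Sum>r\<in>D. w q * w r * (prob (A q \<inter> A r) - prob (A q) * prob (A r)))"
    by (simp add: power2_eq_square sum_product sum_subtractf algebra_simps)
  finally show ?thesis .
qed

lemma (in prob_space) variance_mult_left:
  fixes Z :: "'a \<Rightarrow> real"
  shows "variance (\<lambda>\<omega>. c * Z \<omega>) = c\<^sup>2 * variance Z"
  by (simp add: power_mult_distrib right_diff_distrib[symmetric])

text \<open>Fubini for the joint law of two independent variables, written with both integrals over the
  original probability space: \<open>B\<close> is resampled while \<open>A\<close> is kept.\<close>

lemma (in prob_space) prob_indep_pair:
  assumes "indep_var N A N' B" and S: "S \<in> sets (N \<Otimes>\<^sub>M N')"
  shows "prob {\<omega> \<in> space M. (A \<omega>, B \<omega>) \<in> S}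
      = expectation (\<lambda>\<omega>. prob {\<omega>' \<in> space M. (A \<omega>, B \<omega>') \<in> S})"
    and "(\<lambda>\<omega>. prob {\<omega>' \<in> space M. (A \<omega>, B \<omega>') \<in> S}) \<in> borel_measurable M"
proof -
  have [measurable]: "A \<in> measurable M N" "B \<in> measurable M N'"
    and eq: "distr M N A \<Otimes>\<^sub>M distr M N' B = distr M (N \<Otimes>\<^sub>M N') (\<lambda>x. (A x, B x))"
    using assms(1) unfolding indep_var_distribution_eq by auto
  note [measurable] = S
  interpret B: prob_space "distr M N' B" by (rule prob_space_distr) simp
  have slice: "emeasure (distr M N' B) (Pair x -` S) = prob {\<omega>' \<in> space M. (x, B \<omega>') \<in> S}" for x
    by (subst emeasure_distr) (auto simp: emeasure_eq_measure vimage_def Int_def conj_commute sets_Pair1[OF S, unfolded vimage_def])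
  have S': "S \<in> sets (distr M N A \<Otimes>\<^sub>M distr M N' B)"
    using S by (simp cong: sets_pair_measure_cong)
  have "(\<lambda>x. emeasure (distr M N' B) (Pair x -` S)) \<in> borel_measurable (distr M N A)"
    by (rule B.measurable_emeasure_Pair[OF S'])
  then have m: "(\<lambda>x. prob {\<omega>' \<in> space M. (x, B \<omega>') \<in> S}) \<in> borel_measurable N"
    by (simp add: slice)
  from measurable_compose[OF \<open>A \<in> measurable M N\<close> this]
  show m': "(\<lambda>\<omega>. prob {\<omega>' \<in> space M. (A \<omega>, B \<omega>') \<in> S}) \<in> borel_measurable M" .
  have "ennreal (prob {\<omega> \<in> space M. (A \<omega>, B \<omega>) \<in> S}) = emeasure (distr M (N \<Otimes>\<^sub>M N') (\<lambda>x. (A x, B x))) S"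
    by (subst emeasure_distr) (auto simp: emeasure_eq_measure vimage_def Int_def conj_commute)
  also have "\<dots> = (\<integral>\<^sup>+x. emeasure (distr M N' B) (Pair x -` S) \<partial>distr M N A)"
    unfolding eq[symmetric] by (rule B.emeasure_pair_measure_alt[OF S'])
  also have "\<dots> = (\<integral>\<^sup>+\<omega>. prob {\<omega>' \<in> space M. (A \<omega>, B \<omega>') \<in> S} \<partial>M)"
    unfolding slice using m by (subst nn_integral_distr) auto
  also have "\<dots> = ennreal (expectation (\<lambda>\<omega>. prob {\<omega>' \<in> space M. (A \<omega>, B \<omega>') \<in> S}))"
    using m' by (intro nn_integral_eq_integral integrable_const_bound[of _ 1]) auto
  finally show "prob {\<omega> \<in> space M. (A \<omega>, B \<omega>) \<in> S}
      = expectation (\<lambda>\<omega>. prob {\<omega>' \<in> space M. (A \<omega>, B \<omega>') \<in> S})"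
    by (subst (asm) ennreal_inj) auto
qed

lemma (in prob_space) indep_var_components:
  assumes "indep_vars (\<lambda>_. N) Y I" "i \<in> I" "j \<in> I" "i \<noteq> j"
  shows "indep_var N (Y i) N (Y j)"
proof -
  have "indep_var N ((\<lambda>f. f i) \<circ> (\<lambda>\<omega>. restrict (\<lambda>i. Y i \<omega>) {i})) N ((\<lambda>f. f j) \<circ> (\<lambda>\<omega>. restrict (\<lambda>i. Y i \<omega>) {j}))"
    using assms by (intro indep_var_compose[OF indep_var_restrict[OF assms(1)]] measurable_component_singleton) auto
  then show ?thesis by (simp add: comp_def)
qed

lemma (in prob_space) indep_var_pair_pair:
  assumes "indep_vars (\<lambda>_. N) Y I" "{i, j} \<subseteq> I" "{k, l} \<subseteq> I" "{i, j} \<inter> {k, l} = {}"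
  shows "indep_var (N \<Otimes>\<^sub>M N) (\<lambda>\<omega>. (Y i \<omega>, Y j \<omega>)) (N \<Otimes>\<^sub>M N) (\<lambda>\<omega>. (Y k \<omega>, Y l \<omega>))"
proof -
  have "indep_var (N \<Otimes>\<^sub>M N) ((\<lambda>f. (f i, f j)) \<circ> (\<lambda>\<omega>. restrict (\<lambda>i. Y i \<omega>) {i, j}))
      (N \<Otimes>\<^sub>M N) ((\<lambda>f. (f k, f l)) \<circ> (\<lambda>\<omega>. restrict (\<lambda>i. Y i \<omega>) {k, l}))"
    using assms by (intro indep_var_compose[OF indep_var_restrict[OF assms(1)]] measurable_Pair measurable_component_singleton) auto
  then show ?thesis by (simp add: comp_def)
qed

lemma (in prob_space) indep_vars_rv:
  assumes "indep_vars N Y I" "i \<in> I"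
  shows "random_variable (N i) (Y i)"
  using assms by (auto simp: indep_vars_def)

definition (in prob_space) survival :: "('a \<Rightarrow> real) \<Rightarrow> real \<Rightarrow> real" where
  "survival Z x = prob {\<omega> \<in> space M. Z \<omega> > x}"

text \<open>A survival function is monotone, hence Borel.\<close>

lemma (in prob_space) survival_measurable [measurable]:
  assumes [measurable]: "random_variable borel Z"
  shows "survival Z \<in> borel_measurable borel"
proof -
  have "mono (\<lambda>x. - survival Z x)"
    by (intro monoI) (auto simp: survival_def intro!: finite_measure_mono)
  from borel_measurable_uminus[OF borel_measurable_mono[OF this]] show ?thesis by simp
qed

lemma (in prob_space) survival_bounds: "0 \<le> survival Z x" "survival Z x \<le> 1"
  by (simp_all add: survival_def)

lemma greater_pairs_sets: "{(x, y). x < y} \<in> sets (borel \<Otimes>\<^sub>M (borel :: real measure))"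
proof -
  have "{q \<in> space (borel \<Otimes>\<^sub>M (borel :: real measure)). fst q < snd q} \<in> sets (borel \<Otimes>\<^sub>M borel)"
    by measurable
  then show ?thesis by (simp add: space_pair_measure split_def)
qed

text \<open>Instances of Fubini with the first variable kept. The restriction to a Borel set \<open>B\<close> is what
  identifies the conditional probability given \<open>Y i\<close>, whose defining property tests against events
  of that form.\<close>

lemma (in prob_space) prob_restricted_greater:
  assumes "indep_vars (\<lambda>_. borel) Y I" "i \<in> I" "j \<in> I" "i \<noteq> j" and B: "B \<in> sets borel"
  shows "prob {\<omega> \<in> space M. Y i \<omega> \<in> B \<and> Y j \<omega> > Y i \<omega>}
      = expectation (\<lambda>\<omega>. indicator B (Y i \<omega>) * survival (Y j) (Y i \<omega>))"
proof -
  have S: "{(x, y). x < y} \<inter> (B \<times> UNIV) \<in> sets (borel \<Otimes>\<^sub>M (borel :: real measure))"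
    using greater_pairs_sets B by (intro sets.Int) auto
  have "prob {\<omega> \<in> space M. Y i \<omega> \<in> B \<and> Y j \<omega> > Y i \<omega>} =
    prob {\<omega> \<in> space M. (Y i \<omega>, Y j \<omega>) \<in> {(x, y). x < y} \<inter> (B \<times> UNIV)}"
    by (intro arg_cong[of _ _ prob]) auto
  also have "\<dots> = expectation (\<lambda>\<omega>. prob {\<omega>' \<in> space M. (Y i \<omega>, Y j \<omega>') \<in> {(x, y). x < y} \<inter> (B \<times> UNIV)})"
    using assms by (intro prob_indep_pair(1)[OF _ S] indep_var_components[of borel Y I])
  also have "\<dots> = expectation (\<lambda>\<omega>. indicator B (Y i \<omega>) * survival (Y j) (Y i \<omega>))"
    by (intro Bochner_Integration.integral_cong) (auto simp: survival_def indicator_def)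
  finally show ?thesis .
qed

lemma (in prob_space) prob_greater:
  assumes "indep_vars (\<lambda>_. borel) Y I" "i \<in> I" "j \<in> I" "i \<noteq> j"
  shows "prob {\<omega> \<in> space M. Y j \<omega> > Y i \<omega>} = expectation (\<lambda>\<omega>. survival (Y j) (Y i \<omega>))"
  using prob_restricted_greater[OF assms, of UNIV] by simp

lemma (in prob_space) prob_both_greater:
  assumes "indep_vars (\<lambda>_. borel) Y I" "i \<in> I" "j \<in> I" "k \<in> I" "i \<noteq> j" "i \<noteq> k" "j \<noteq> k"
  shows "prob {\<omega> \<in> space M. Y j \<omega> > Y i \<omega> \<and> Y k \<omega> > Y i \<omega>}
      = expectation (\<lambda>\<omega>. survival (Y j) (Y i \<omega>) * survival (Y k) (Y i \<omega>))"
proof -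
  \<comment> \<open>Both independent blocks must have the same type, so the single variable is doubled.\<close>
  define S :: "((real \<times> real) \<times> (real \<times> real)) set" where "S = {((x, _), (y, z)). x < y \<and> x < z}"
  let ?B = "borel :: real measure"
  have "{q \<in> space ((?B \<Otimes>\<^sub>M ?B) \<Otimes>\<^sub>M (?B \<Otimes>\<^sub>M ?B)).
      fst (fst q) < fst (snd q) \<and> fst (fst q) < snd (snd q)} \<in> sets ((?B \<Otimes>\<^sub>M ?B) \<Otimes>\<^sub>M (?B \<Otimes>\<^sub>M ?B))"
    by measurable
  then have S: "S \<in> sets ((?B \<Otimes>\<^sub>M ?B) \<Otimes>\<^sub>M (?B \<Otimes>\<^sub>M ?B))"
    by (simp add: space_pair_measure split_def S_def)
  have "prob {\<omega> \<in> space M. Y j \<omega> > Y i \<omega> \<and> Y k \<omega> > Y i \<omega>}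
      = prob {\<omega> \<in> space M. ((Y i \<omega>, Y i \<omega>), (Y j \<omega>, Y k \<omega>)) \<in> S}"
    by (simp add: S_def)
  also have "\<dots> = expectation (\<lambda>\<omega>. prob {\<omega>' \<in> space M. ((Y i \<omega>, Y i \<omega>), (Y j \<omega>', Y k \<omega>')) \<in> S})"
    using assms by (intro prob_indep_pair(1)[OF _ S] indep_var_pair_pair[of borel Y I]) auto
  also have "\<dots> = expectation (\<lambda>\<omega>. survival (Y j) (Y i \<omega>) * survival (Y k) (Y i \<omega>))"
  proof (intro Bochner_Integration.integral_cong refl)
    fix \<omega>
    have "prob ((\<lambda>\<omega>'. (Y j \<omega>', Y k \<omega>')) -` ({Y i \<omega><..} \<times> {Y i \<omega><..}) \<inter> space M)
        = prob (Y j -` {Y i \<omega><..} \<inter> space M) * prob (Y k -` {Y i \<omega><..} \<inter> space M)"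
      using assms by (intro indep_varD[of borel _ borel] indep_var_components[of borel Y I]) auto
    moreover have "(\<lambda>\<omega>'. (Y j \<omega>', Y k \<omega>')) -` ({Y i \<omega><..} \<times> {Y i \<omega><..}) \<inter> space M
        = {\<omega>' \<in> space M. ((Y i \<omega>, Y i \<omega>), (Y j \<omega>', Y k \<omega>')) \<in> S}"
      by (auto simp: S_def)
    moreover have "Y j -` {Y i \<omega><..} \<inter> space M = {\<omega>' \<in> space M. Y j \<omega>' > Y i \<omega>}" for j
      by auto
    ultimately show "prob {\<omega>' \<in> space M. ((Y i \<omega>, Y i \<omega>), (Y j \<omega>', Y k \<omega>')) \<in> S} =
        survival (Y j) (Y i \<omega>) * survival (Y k) (Y i \<omega>)"
      by (simp add: survival_def)
  qed
  finally show ?thesis .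
qed

text \<open>A tie means that \<open>Y j\<close> hits the value of \<open>Y i\<close>, so it is no likelier than the largest atom of \<open>Y j\<close>.\<close>

lemma (in prob_space) prob_tie_le:
  fixes Y :: "'i \<Rightarrow> 'a \<Rightarrow> real" and c :: real
  assumes "indep_vars (\<lambda>_. borel) Y I" "i \<in> I" "j \<in> I" "i \<noteq> j"
    and atom: "\<And>x. prob {\<omega> \<in> space M. Y j \<omega> = x} \<le> c"
  shows "prob {\<omega> \<in> space M. Y i \<omega> = Y j \<omega>} \<le> c"
proof -
  have "{q \<in> space (borel \<Otimes>\<^sub>M (borel :: real measure)). snd q = fst q} \<in> sets (borel \<Otimes>\<^sub>M borel)"
    by measurable
  then have S: "{(x :: real, y). y = x} \<in> sets (borel \<Otimes>\<^sub>M borel)"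
    by (simp add: space_pair_measure split_def)
  have iv: "indep_var borel (Y i) borel (Y j)"
    using assms by (intro indep_var_components[of borel Y I])
  have "prob {\<omega> \<in> space M. Y i \<omega> = Y j \<omega>} = expectation (\<lambda>\<omega>. prob {\<omega>' \<in> space M. Y j \<omega>' = Y i \<omega>})"
    using prob_indep_pair(1)[OF iv S] by (simp add: eq_commute)
  also have "\<dots> \<le> expectation (\<lambda>\<omega>. c)"
    using prob_indep_pair(2)[OF iv S] atom
    by (intro integral_mono integrable_const integrable_const_bound[of _ 1]) auto
  finally show ?thesis by (simp add: prob_space)
qed

lemma (in prob_space) cond_prob_gt_eq_survival:
  assumes ind: "indep_vars (\<lambda>_. borel) Y I" and ij: "i \<in> I" "j \<in> I" "i \<noteq> j"
  shows "AE \<omega> in M. cond_prob_gt M Y j i \<omega> = survival (Y j) (Y i \<omega>)"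
proof -
  define F where "F = vimage_algebra (space M) (Y i) borel"
  have [measurable]: "random_variable borel (Y i)" "random_variable borel (Y j)"
    using indep_vars_rv[OF ind] ij by auto
  have sub: "subalgebra M F"
    unfolding subalgebra_def F_def by (auto simp: sets_vimage_algebra2)
  interpret finite_measure_subalgebra M F
    by unfold_locales (rule sub)
  have ev: "{\<omega> \<in> space M. Y j \<omega> > Y i \<omega>} \<in> events" by measurable
  have "AE \<omega> in M. real_cond_exp M F (indicator {\<omega> \<in> space M. Y j \<omega> > Y i \<omega>}) \<omega> = survival (Y j) (Y i \<omega>)"
  proof (rule real_cond_exp_charact)
    show "integrable M (indicator {\<omega> \<in> space M. Y j \<omega> > Y i \<omega>} :: _ \<Rightarrow> real)"
      using ev by (simp add: emeasure_eq_measure)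
    show "integrable M (\<lambda>\<omega>. survival (Y j) (Y i \<omega>))"
      by (intro integrable_const_bound[of _ 1]) (auto simp: survival_bounds)
    have "Y i \<in> measurable F borel"
      unfolding F_def by (rule measurable_vimage_algebra1) auto
    then show "(\<lambda>\<omega>. survival (Y j) (Y i \<omega>)) \<in> borel_measurable F"
      by measurable
    fix A assume "A \<in> sets F"
    then obtain B where B: "B \<in> sets borel" and A: "A = Y i -` B \<inter> space M"
      unfolding F_def by (auto simp: sets_vimage_algebra2)
    have "(\<integral>\<omega>\<in>A. indicator {\<omega> \<in> space M. Y j \<omega> > Y i \<omega>} \<omega> \<partial>M)
       = (\<integral>\<omega>. indicator {\<omega> \<in> space M. Y i \<omega> \<in> B \<and> Y j \<omega> > Y i \<omega>} \<omega> \<partial>M)"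
      unfolding set_lebesgue_integral_def A
      by (intro Bochner_Integration.integral_cong) (auto simp: indicator_def)
    also have "\<dots> = prob {\<omega> \<in> space M. Y i \<omega> \<in> B \<and> Y j \<omega> > Y i \<omega>}"
      by (simp add: Int_def conj_ac)
    also have "\<dots> = expectation (\<lambda>\<omega>. indicator B (Y i \<omega>) * survival (Y j) (Y i \<omega>))"
      by (rule prob_restricted_greater[OF ind ij B])
    also have "\<dots> = (\<integral>\<omega>\<in>A. survival (Y j) (Y i \<omega>) \<partial>M)"
      unfolding set_lebesgue_integral_def A
      by (intro Bochner_Integration.integral_cong) (auto simp: indicator_def)
    finally show "(\<integral>\<omega>\<in>A. indicator {\<omega> \<in> space M. Y j \<omega> > Y i \<omega>} \<omega> \<partial>M) = (\<integral>\<omega>\<in>A. survival (Y j) (Y i \<omega>) \<partial>M)" .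
  qed
  then show ?thesis
    by (simp add: cond_prob_gt_def cond_prob_given_def F_def)
qed

lemma (in prob_space) expectation_cond_prob_gt_product:
  assumes ind: "indep_vars (\<lambda>_. borel) Y I"
    and ijk: "i \<in> I" "j \<in> I" "k \<in> I" "i \<noteq> j" "i \<noteq> k" "j \<noteq> k"
  shows "expectation (\<lambda>\<omega>. cond_prob_gt M Y j i \<omega> * cond_prob_gt M Y k i \<omega>)
      = prob {\<omega> \<in> space M. Y j \<omega> > Y i \<omega> \<and> Y k \<omega> > Y i \<omega>}"
proof -
  have [measurable]: "random_variable borel (Y i)" "random_variable borel (Y j)" "random_variable borel (Y k)"
    using indep_vars_rv[OF ind] ijk by auto
  have [measurable]: "cond_prob_gt M Y j i \<in> borel_measurable M" for j
    unfolding cond_prob_gt_def cond_prob_given_def by measurable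
  have "expectation (\<lambda>\<omega>. cond_prob_gt M Y j i \<omega> * cond_prob_gt M Y k i \<omega>)
      = expectation (\<lambda>\<omega>. survival (Y j) (Y i \<omega>) * survival (Y k) (Y i \<omega>))"
    using cond_prob_gt_eq_survival[OF ind ijk(1,2,4)] cond_prob_gt_eq_survival[OF ind ijk(1,3,5)]
    by (intro integral_cong_AE) auto
  also have "\<dots> = prob {\<omega> \<in> space M. Y j \<omega> > Y i \<omega> \<and> Y k \<omega> > Y i \<omega>}"
    by (rule prob_both_greater[OF ind ijk, symmetric])
  finally show ?thesis .
qed

section \<open>The variance for nearly exchangeable samples\<close>

text \<open>The common abstraction of the data and of a bootstrap sample. The constants \<open>\<theta>\<close> and \<open>\<eta>2\<close> are left
  arbitrary: it is enough that the probabilities are nearly equal to each other, because their values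
  then follow from counting orders.\<close>

locale nearly_exchangeable = prob_space M for M :: "'a measure" +
  fixes Y :: "nat \<Rightarrow> 'a \<Rightarrow> real" and n :: nat and \<theta> \<eta>2 e :: real
  assumes indep: "indep_vars (\<lambda>_. borel) Y {1..n}"
    and n_ge: "n \<ge> 3"
    and pair: "\<And>i j. i \<in> {1..n} \<Longrightarrow> j \<in> {1..n} \<Longrightarrow> i \<noteq> j \<Longrightarrow>
      \<bar>prob {\<omega> \<in> space M. Y j \<omega> > Y i \<omega>} - \<theta>\<bar> \<le> e"
    and triple: "\<And>i j k. i \<in> {1..n} \<Longrightarrow> j \<in> {1..n} \<Longrightarrow> k \<in> {1..n} \<Longrightarrow> i \<noteq> j \<Longrightarrow> i \<noteq> k \<Longrightarrow> j \<noteq> k \<Longrightarrow>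
      \<bar>prob {\<omega> \<in> space M. Y j \<omega> > Y i \<omega> \<and> Y k \<omega> > Y i \<omega>} - \<eta>2\<bar> \<le> e"
    and tie: "\<And>i j. i \<in> {1..n} \<Longrightarrow> j \<in> {1..n} \<Longrightarrow> i \<noteq> j \<Longrightarrow>
      prob {\<omega> \<in> space M. Y i \<omega> = Y j \<omega>} \<le> e"
begin

text \<open>The argument order is that of \<open>prob_gt\<close>: the first index carries the larger value. The
  comparison belonging to the ordered pair $(i, j)$ is \<open>gt j i\<close>.\<close>

definition gt :: "nat \<Rightarrow> nat \<Rightarrow> 'a set" where
  "gt j i = {\<omega> \<in> space M. Y j \<omega> > Y i \<omega>}"

definition eq :: "nat \<Rightarrow> nat \<Rightarrow> 'a set" where
  "eq i j = {\<omega> \<in> space M. Y i \<omega> = Y j \<omega>}"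

lemma gt_events: "i \<in> {1..n} \<Longrightarrow> j \<in> {1..n} \<Longrightarrow> gt j i \<in> events"
  and eq_events: "i \<in> {1..n} \<Longrightarrow> j \<in> {1..n} \<Longrightarrow> eq i j \<in> events"
proof -
  assume "i \<in> {1..n}" "j \<in> {1..n}"
  then have [measurable]: "random_variable borel (Y i)" "random_variable borel (Y j)"
    using indep_vars_rv[OF indep] by auto
  show "gt j i \<in> events" unfolding gt_def by measurable
  show "eq i j \<in> events" unfolding eq_def by measurable
qed

lemma e_nonneg: "0 \<le> e"
  using n_ge by (intro order_trans[OF measure_nonneg tie[of 1 2]]) auto

lemma prob_gt_add:
  assumes "i \<in> {1..n}" "j \<in> {1..n}" "i \<noteq> j"
  shows "prob (gt j i) + prob (gt i j) \<le> 1" "1 - e \<le> prob (gt j i) + prob (gt i j)"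
proof -
  have ev: "gt j i \<in> events" "gt i j \<in> events" "eq i j \<in> events"
    using assms gt_events eq_events by auto
  have "prob (gt j i \<union> gt i j) = prob (gt j i) + prob (gt i j)"
    using ev by (intro finite_measure_Union) (auto simp: gt_def)
  then show "prob (gt j i) + prob (gt i j) \<le> 1"
    by (metis prob_le_1)
  have cover: "space M = (gt j i \<union> gt i j) \<union> eq i j"
    by (auto simp: gt_def eq_def)
  then have "1 \<le> prob (gt j i \<union> gt i j) + prob (eq i j)"
    using measure_Un_le[of "gt j i \<union> gt i j" M "eq i j"] ev
      prob_space by (simp add: cover[symmetric])
  moreover have "prob (eq i j) \<le> e"
    using tie assms by (simp add: eq_def)
  moreover have "prob (gt j i \<union> gt i j) \<le> prob (gt j i) + prob (gt i j)"
    using ev by (intro measure_Un_le) auto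
  ultimately show "1 - e \<le> prob (gt j i) + prob (gt i j)" by simp
qed

lemma prob_gt_half:
  assumes "i \<in> {1..n}" "j \<in> {1..n}" "i \<noteq> j"
  shows "\<bar>prob (gt j i) - 1 / 2\<bar> \<le> 3 * e"
  using prob_gt_add[OF assms] pair[OF assms] pair[OF assms(2,1)] assms(3) e_nonneg
  unfolding gt_def[symmetric] by (simp add: abs_le_iff)

text \<open>Up to ties, exactly one of three values is the strict minimum, and the three candidates are
  nearly equally likely.\<close>

lemma prob_gt_Int_third:
  assumes "i \<in> {1..n}" "j \<in> {1..n}" "k \<in> {1..n}" "i \<noteq> j" "i \<noteq> k" "j \<noteq> k"
  shows "\<bar>prob (gt j i \<inter> gt k i) - 1 / 3\<bar> \<le> 3 * e"
proof -
  have int: "gt b a \<inter> gt c a = {\<omega> \<in> space M. Y b \<omega> > Y a \<omega> \<and> Y c \<omega> > Y a \<omega>}" for a b c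
    by (auto simp: gt_def)
  let ?A = "gt j i \<inter> gt k i" and ?B = "gt i j \<inter> gt k j" and ?C = "gt i k \<inter> gt j k"
  have ev: "?A \<in> events" "?B \<in> events" "?C \<in> events"
    "eq i j \<in> events" "eq i k \<in> events" "eq j k \<in> events"
    using assms gt_events eq_events by auto
  have near: "\<bar>prob ?A - \<eta>2\<bar> \<le> e" "\<bar>prob ?B - \<eta>2\<bar> \<le> e" "\<bar>prob ?C - \<eta>2\<bar> \<le> e"
    unfolding int using assms by (auto intro!: triple)
  have "prob (?A \<union> ?B \<union> ?C) = prob (?A \<union> ?B) + prob ?C"
    using ev by (intro finite_measure_Union) (auto simp: gt_def)
  moreover have "prob (?A \<union> ?B) = prob ?A + prob ?B"
    using ev by (intro finite_measure_Union) (auto simp: gt_def)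
  ultimately have sum: "prob (?A \<union> ?B \<union> ?C) = prob ?A + prob ?B + prob ?C" by simp
  then have upper: "prob ?A + prob ?B + prob ?C \<le> 1" by (metis prob_le_1)
  have cover: "space M = (?A \<union> ?B \<union> ?C) \<union> (eq i j \<union> eq i k \<union> eq j k)"
    by (auto simp: gt_def eq_def)
  then have "1 \<le> prob (?A \<union> ?B \<union> ?C) + prob (eq i j \<union> eq i k \<union> eq j k)"
    using measure_Un_le[of "?A \<union> ?B \<union> ?C" M "eq i j \<union> eq i k \<union> eq j k"] ev
      prob_space by (simp add: cover[symmetric] sets.Un)
  moreover have "prob (eq i j \<union> eq i k \<union> eq j k) \<le> prob (eq i j) + prob (eq i k) + prob (eq j k)"
    using measure_Un_le[of "eq i j \<union> eq i k" M "eq j k"]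
      measure_Un_le[of "eq i j" M "eq i k"] ev by (simp add: sets.Un)
  moreover have "prob (eq i j) \<le> e" "prob (eq i k) \<le> e" "prob (eq j k) \<le> e"
    using tie assms by (simp_all add: eq_def)
  ultimately have lower: "1 - 3 * e \<le> prob ?A + prob ?B + prob ?C"
    using sum by linarith
  show ?thesis
    using near upper lower e_nonneg by (simp add: abs_le_iff)
qed

text \<open>The complement of \<open>gt i j\<close> is the weak inequality; replacing it by the strict one costs the
  probability of a tie.\<close>

lemma prob_ge_approx:
  assumes "i \<in> {1..n}" "j \<in> {1..n}" "i \<noteq> j" "A \<in> events"
  shows "prob (gt j i \<inter> A) \<le> prob (A - gt i j)" "prob (A - gt i j) \<le> prob (gt j i \<inter> A) + e"
proof -
  have ev: "gt j i \<in> events" "gt i j \<in> events" "eq i j \<in> events"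
    using assms gt_events eq_events by auto
  show "prob (gt j i \<inter> A) \<le> prob (A - gt i j)"
    using ev assms by (intro finite_measure_mono) (auto simp: gt_def)
  have "prob (A - gt i j) \<le> prob ((gt j i \<inter> A) \<union> eq i j)"
    using ev assms sets.sets_into_space[OF assms(4)]
    by (intro finite_measure_mono) (auto simp: gt_def eq_def)
  also have "\<dots> \<le> prob (gt j i \<inter> A) + prob (eq i j)"
    using ev assms by (intro measure_Un_le) auto
  also have "prob (eq i j) \<le> e"
    using tie assms by (simp add: eq_def)
  finally show "prob (A - gt i j) \<le> prob (gt j i \<inter> A) + e" by simp
qed

text \<open>Up to ties, if \<open>Y j > Y i\<close>, then either \<open>Y k < Y i\<close>, or \<open>Y i\<close> is a minimum of all three: $1/2 - 1/3 = 1/6$.\<close>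

lemma prob_gt_chain_sixth:
  assumes "i \<in> {1..n}" "j \<in> {1..n}" "k \<in> {1..n}" "i \<noteq> j" "i \<noteq> k" "j \<noteq> k"
  shows "\<bar>prob (gt j i \<inter> gt i k) - 1 / 6\<bar> \<le> 7 * e"
proof -
  have ev: "gt j i \<in> events" "gt i k \<in> events"
    using assms gt_events by auto
  have "prob (gt j i) = prob (gt j i \<inter> gt i k) + prob (gt j i - gt i k)"
    using ev by (simp add: finite_measure_Diff' Int_commute)
  moreover have "prob (gt k i \<inter> gt j i) \<le> prob (gt j i - gt i k)" "prob (gt j i - gt i k) \<le> prob (gt k i \<inter> gt j i) + e"
    using prob_ge_approx[of i k "gt j i"] assms ev by auto
  moreover have "\<bar>prob (gt k i \<inter> gt j i) - 1 / 3\<bar> \<le> 3 * e"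
    using prob_gt_Int_third[of i k j] assms by auto
  moreover have "\<bar>prob (gt j i) - 1 / 2\<bar> \<le> 3 * e"
    using prob_gt_half[of i j] assms by auto
  ultimately show ?thesis by (simp add: abs_le_iff)
qed

text \<open>The maximum of three values. Up to ties, if \<open>Y j > Y i\<close>, then either \<open>Y j > Y k\<close>, or the values increase along
  $i, j, k$: $1/2 - 1/6 = 1/3$.\<close>

lemma prob_gt_Int_third':
  assumes "i \<in> {1..n}" "j \<in> {1..n}" "k \<in> {1..n}" "i \<noteq> j" "i \<noteq> k" "j \<noteq> k"
  shows "\<bar>prob (gt j i \<inter> gt j k) - 1 / 3\<bar> \<le> 11 * e"
proof -
  have ev: "gt j i \<in> events" "gt j k \<in> events"
    using assms gt_events by auto
  have "prob (gt j i) = prob (gt j i \<inter> gt j k) + prob (gt j i - gt j k)"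
    using ev by (simp add: finite_measure_Diff' Int_commute)
  moreover have "prob (gt k j \<inter> gt j i) \<le> prob (gt j i - gt j k)" "prob (gt j i - gt j k) \<le> prob (gt k j \<inter> gt j i) + e"
    using prob_ge_approx[of j k "gt j i"] assms ev by auto
  moreover have "\<bar>prob (gt k j \<inter> gt j i) - 1 / 6\<bar> \<le> 7 * e"
    using prob_gt_chain_sixth[of j k i] assms by auto
  moreover have "\<bar>prob (gt j i) - 1 / 2\<bar> \<le> 3 * e"
    using prob_gt_half[of i j] assms by auto
  ultimately show ?thesis by (simp add: abs_le_iff)
qed

lemma prob_gt_mult_quarter:
  assumes "i \<in> {1..n}" "j \<in> {1..n}" "i \<noteq> j" "k \<in> {1..n}" "l \<in> {1..n}" "k \<noteq> l"
  shows "\<bar>prob (gt j i) * prob (gt l k) - 1 / 4\<bar> \<le> 5 * e"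
proof -
  define s t where "s = prob (gt j i) - 1 / 2" and "t = prob (gt l k) - 1 / 2"
  have "\<bar>s * prob (gt l k)\<bar> \<le> 3 * e * 1"
    unfolding abs_mult s_def using prob_gt_half[OF assms(1-3)] e_nonneg by (intro mult_mono) auto
  moreover have "\<bar>t\<bar> \<le> 3 * e"
    using prob_gt_half[OF assms(4-6)] by (simp add: t_def)
  ultimately have "\<bar>s * prob (gt l k) + t / 2\<bar> \<le> 5 * e"
    using e_nonneg by linarith
  moreover have "prob (gt j i) * prob (gt l k) - 1 / 4 = s * prob (gt l k) + t / 2"
    by (simp add: s_def t_def field_simps)
  ultimately show ?thesis by simp
qed

lemma prob_gt_Int_disjoint:
  assumes "{i, j} \<subseteq> {1..n}" "{k, l} \<subseteq> {1..n}" "{i, j} \<inter> {k, l} = {}"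
  shows "prob (gt j i \<inter> gt l k) = prob (gt j i) * prob (gt l k)"
proof -
  let ?G = "{(x :: real, y). x < y}"
  have pre: "gt b a = (\<lambda>\<omega>. (Y a \<omega>, Y b \<omega>)) -` ?G \<inter> space M" for a b
    by (auto simp: gt_def)
  have "prob ((\<lambda>\<omega>. ((Y i \<omega>, Y j \<omega>), (Y k \<omega>, Y l \<omega>))) -` (?G \<times> ?G) \<inter> space M)
      = prob (gt j i) * prob (gt l k)"
    unfolding pre using greater_pairs_sets
    by (intro indep_varD[OF indep_var_pair_pair[OF indep assms]]) auto
  moreover have "(\<lambda>\<omega>. ((Y i \<omega>, Y j \<omega>), (Y k \<omega>, Y l \<omega>))) -` (?G \<times> ?G) \<inter> space M = gt j i \<inter> gt l k"
    by (auto simp: gt_def)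
  ultimately show ?thesis by simp
qed

text \<open>The sign of the overlap distinguishes a shared index in equal roles ($1/3 - 1/4$) from one in
  opposite roles ($1/6 - 1/4$). Two pairs with $j < i$ and $l < k$ cannot share both indices in
  opposite roles, so only $q = r$ has overlap $2$; there the true covariance differs from $2/12$,
  and the crude bound $1$ is good enough because there are few such terms.\<close>

lemma covariance_approx:
  assumes q: "q \<in> ordered_pairs n" and r: "r \<in> ordered_pairs n"
  shows "\<bar>prob (gt (snd q) (fst q) \<inter> gt (snd r) (fst r)) - prob (gt (snd q) (fst q)) * prob (gt (snd r) (fst r))
      - overlap (- 1) q r / 12\<bar> \<le> 16 * e * overlap 1 q r + of_bool (q = r)"
proof -
  obtain i j where qeq: "q = (i, j)" by (cases q)
  obtain k l where req: "r = (k, l)" by (cases r)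
  have ij: "i \<in> {1..n}" "j \<in> {1..n}" "j < i" and kl: "k \<in> {1..n}" "l \<in> {1..n}" "l < k"
    using q r by (auto simp: qeq req mem_ordered_pairs)
  have quarter: "\<bar>prob (gt j i) * prob (gt l k) - 1 / 4\<bar> \<le> 5 * e"
    using prob_gt_mult_quarter ij kl by auto
  consider "q = r" | "i = k" "j \<noteq> l" | "j = l" "i \<noteq> k" | "i = l" | "j = k" | "{i, j} \<inter> {k, l} = {}"
    by (auto simp: qeq req)
  then have "\<bar>prob (gt j i \<inter> gt l k) - prob (gt j i) * prob (gt l k) - overlap (- 1) (i, j) (k, l) / 12\<bar>
      \<le> 16 * e * overlap 1 (i, j) (k, l) + of_bool (q = r)"
  proof cases
    case 1
    have "0 \<le> prob (gt j i) * prob (gt j i)" "prob (gt j i) * prob (gt j i) \<le> prob (gt j i)"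
      by (auto intro: mult_left_le)
    moreover have "0 \<le> prob (gt j i)" "prob (gt j i) \<le> 1"
      by auto
    ultimately have "\<bar>prob (gt j i) - prob (gt j i) * prob (gt j i) - 1 / 6\<bar> \<le> 1"
      unfolding abs_le_iff by linarith
    then show ?thesis
      using 1 ij e_nonneg by (simp add: qeq req overlap_def)
  next
    case 2
    then show ?thesis
      using prob_gt_Int_third[of i j l] quarter ij kl e_nonneg by (simp add: qeq req overlap_def abs_le_iff)
  next
    case 3
    then show ?thesis
      using prob_gt_Int_third'[of i j k] quarter ij kl e_nonneg by (simp add: qeq req overlap_def abs_le_iff)
  next
    case 4
    have "prob (gt j i \<inter> gt l k) = prob (gt i k \<inter> gt j i)" using 4 by (simp add: Int_commute)
    then show ?thesis
      using 4 prob_gt_chain_sixth[of i j k] quarter ij kl e_nonneg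
      by (simp add: qeq req overlap_def abs_le_iff Int_commute)
  next
    case 5
    then show ?thesis
      using prob_gt_chain_sixth[of j l i] quarter ij kl e_nonneg
      by (simp add: qeq req overlap_def abs_le_iff Int_commute)
  next
    case 6
    then show ?thesis
      using prob_gt_Int_disjoint[of i j k l] ij kl e_nonneg
      by (simp add: qeq req overlap_def)
  qed
  then show ?thesis by (simp add: qeq req)
qed

theorem variance_U_AP_approx:
  "\<bar>(real n - 1) * variance (\<lambda>\<omega>. U_AP n (\<lambda>i. Y i \<omega>)) - 1 / 12\<bar>
     \<le> 80 * e + 2 * harm (n - 1) / (real n - 1)"
proof -
  let ?P = "ordered_pairs n"
  let ?A = "\<lambda>q. gt (snd q) (fst q)"
  let ?U = "\<lambda>\<omega>. U_AP n (\<lambda>i. Y i \<omega>)"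
  define cov where "cov q r = prob (?A q \<inter> ?A r) - prob (?A q) * prob (?A r)" for q r
  have n1: "real n - 1 > 0" using n_ge by simp
  have "(real n - 1)\<^sup>2 * variance ?U = variance (\<lambda>\<omega>. (real n - 1) * ?U \<omega>)"
    by (simp add: power_mult_distrib right_diff_distrib[symmetric])
  also have "\<dots> = variance (\<lambda>\<omega>. \<Sum>q\<in>?P. weight q * indicator (?A q) \<omega>)"
  proof -
    have U: "(real n - 1) * ?U \<omega> = (\<Sum>q\<in>?P. weight q * indicator (?A q) \<omega>)" if "\<omega> \<in> space M" for \<omega>
      using U_AP_eq_sum_pairs[of n "\<lambda>i. Y i \<omega>"] n_ge that
      by (simp add: gt_def indicator_def of_bool_def)
    then have "expectation (\<lambda>\<omega>. (real n - 1) * ?U \<omega>) = expectation (\<lambda>\<omega>. \<Sum>q\<in>?P. weight q * indicator (?A q) \<omega>)"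
      by (rule Bochner_Integration.integral_cong[OF refl])
    then show ?thesis
      using U by (intro Bochner_Integration.integral_cong refl) (simp del: integral_mult_right_zero)
  qed
  also have "\<dots> = (\<Sum>q\<in>?P. \<Sum>r\<in>?P. weight q * weight r * cov q r)"
    unfolding cov_def using gt_events
    by (intro variance_sum_indicators) (auto simp: mem_ordered_pairs)
  finally have var: "(real n - 1)\<^sup>2 * variance ?U = (\<Sum>q\<in>?P. \<Sum>r\<in>?P. weight q * weight r * cov q r)" .
  have diag: "(\<Sum>q\<in>?P. \<Sum>r\<in>?P. weight q * weight r * of_bool (q = r)) = harm (n - 1)"
  proof -
    have "(\<Sum>r\<in>?P. weight q * weight r * of_bool (q = r)) = (weight q)\<^sup>2" if "q \<in> ?P" for q
    proof -
      have "(\<Sum>r\<in>?P. weight q * weight r * of_bool (q = r)) = (\<Sum>r\<in>?P. if q = r then weight q * weight r else 0)"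
        by (intro sum.cong) auto
      then show ?thesis using that by (simp add: power2_eq_square)
    qed
    then show ?thesis
      using sum_weight_square[of n] n_ge by simp
  qed
  have "(\<Sum>q\<in>?P. \<Sum>r\<in>?P. weight q * weight r * cov q r) - energy (- 1) n / 12
      = (\<Sum>q\<in>?P. \<Sum>r\<in>?P. weight q * weight r * (cov q r - overlap (- 1) q r / 12))"
    unfolding sum_weight_overlap[symmetric]
    by (simp add: sum_subtractf sum_divide_distrib right_diff_distrib)
  also have "\<bar>\<dots>\<bar> \<le> (\<Sum>q\<in>?P. \<Sum>r\<in>?P. weight q * weight r * (16 * e * overlap 1 q r + of_bool (q = r)))"
  proof (intro order_trans[OF sum_abs] sum_mono)
    fix q r assume qr: "q \<in> ?P" "r \<in> ?P"
    show "\<bar>weight q * weight r * (cov q r - overlap (- 1) q r / 12)\<bar>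
        \<le> weight q * weight r * (16 * e * overlap 1 q r + of_bool (q = r))"
      using mult_left_mono[OF covariance_approx[OF qr], of "weight q * weight r"] weight_nonneg qr
      by (simp add: abs_mult cov_def)
  qed
  also have "\<dots> = (\<Sum>q\<in>?P. \<Sum>r\<in>?P. 16 * e * (weight q * weight r * overlap 1 q r))
      + (\<Sum>q\<in>?P. \<Sum>r\<in>?P. weight q * weight r * of_bool (q = r))"
    unfolding sum.distrib[symmetric] by (intro sum.cong refl) (simp only: distrib_left mult_ac)
  also have "\<dots> = 16 * e * energy 1 n + harm (n - 1)"
    unfolding sum_distrib_left[symmetric] sum_weight_overlap diag ..
  also have "16 * e * energy 1 n \<le> 16 * e * (5 * (real n - 1))"
    using e_nonneg energy_plus[of n] n_ge by (intro mult_left_mono) auto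
  finally have "\<bar>(real n - 1)\<^sup>2 * variance ?U - (real n - 1 + harm (n - 1)) / 12\<bar>
      \<le> 80 * e * (real n - 1) + harm (n - 1)"
    using var energy_minus[of n] n_ge by (simp add: algebra_simps)
  then have bound: "\<bar>(real n - 1)\<^sup>2 * variance ?U - (real n - 1) / 12\<bar> \<le> 80 * e * (real n - 1) + 2 * harm (n - 1)"
    using harm_nonneg[of "n - 1", where 'a = real] by (simp add: abs_le_iff field_simps)
  have "(real n - 1) * variance ?U - 1 / 12 = ((real n - 1)\<^sup>2 * variance ?U - (real n - 1) / 12) / (real n - 1)"
    using n1 by (simp add: field_simps power2_eq_square)
  then have "\<bar>(real n - 1) * variance ?U - 1 / 12\<bar> = \<bar>(real n - 1)\<^sup>2 * variance ?U - (real n - 1) / 12\<bar> / (real n - 1)"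
    using n1 by simp
  also have "\<dots> \<le> (80 * e * (real n - 1) + 2 * harm (n - 1)) / (real n - 1)"
    using bound n1 by (intro divide_right_mono) auto
  finally show ?thesis
    using n1 by (simp add: add_divide_distrib)
qed

end

section \<open>The bootstrap sample\<close>

lemma map_bootstrap_pmf_component:
  "i \<in> {1..n} \<Longrightarrow> map_pmf (\<lambda>f. f i) (bootstrap_pmf n x) = empirical_pmf n x"
  unfolding bootstrap_pmf_def by (subst Pi_pmf_component) auto

text \<open>A value of the empirical distribution carries mass $1/n$ precisely because the data are distinct.\<close>

lemma prob_empirical_atom_le:
  assumes "inj_on x {1..n}" "n \<ge> 1"
  shows "measure_pmf.prob (empirical_pmf n x) {y} \<le> 1 / real n"
proof -
  have "card ({1..n} \<inter> x -` {y}) \<le> 1"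
    using assms(1) by (intro card_le_Suc0_iff_eq[THEN iffD2, simplified One_nat_def[symmetric]]) (auto dest: inj_onD)
  then show ?thesis
    using assms(2) by (simp add: empirical_pmf_def measure_pmf_of_set divide_right_mono)
qed

text \<open>The draws are i.i.d., so pair and triple probabilities are the same for all indices, whatever
  the data are: they are the first two moments of the survival function of the empirical
  distribution. Only ties cause an error.\<close>

lemma bootstrap_nearly_exchangeable:
  assumes inj: "inj_on x {1..n}" and n: "n \<ge> 3"
  shows "\<exists>\<theta> \<eta>2. nearly_exchangeable (measure_pmf (bootstrap_pmf n x)) (\<lambda>i f. f i) n \<theta> \<eta>2 (1 / real n)"
proof -
  let ?B = "bootstrap_pmf n x"
  define G where "G y = measure_pmf.prob (empirical_pmf n x) {y<..}" for y
  have survival: "measure_pmf.survival ?B (\<lambda>f. f j) = G" if "j \<in> {1..n}" for j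
  proof
    fix y
    show "measure_pmf.survival ?B (\<lambda>f. f j) y = G y"
      unfolding G_def map_bootstrap_pmf_component[OF that, of x, symmetric]
      by (simp add: measure_pmf.survival_def vimage_def)
  qed
  have expectation: "measure_pmf.expectation ?B (\<lambda>f. g (f i)) = measure_pmf.expectation (empirical_pmf n x) g"
    if "i \<in> {1..n}" for i and g :: "real \<Rightarrow> real"
    unfolding map_bootstrap_pmf_component[OF that, of x, symmetric] by simp
  have ind: "prob_space.indep_vars (measure_pmf ?B) (\<lambda>_. borel) (\<lambda>i f. f i :: real) {1..n}"
  proof -
    have "prob_space.indep_vars (measure_pmf ?B) (\<lambda>_. count_space UNIV) (\<lambda>i f. f i) {1..n}"
      unfolding bootstrap_pmf_def by (rule indep_vars_Pi_pmf) simp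
    then have "prob_space.indep_vars (measure_pmf ?B) (\<lambda>_. borel) (\<lambda>i. (\<lambda>y. y) \<circ> (\<lambda>f. f i)) {1..n}"
      by (rule prob_space.indep_vars_compose[OF measure_pmf.prob_space_axioms]) auto
    then show ?thesis by (simp add: comp_def)
  qed
  have "nearly_exchangeable (measure_pmf ?B) (\<lambda>i f. f i) n
      (measure_pmf.expectation (empirical_pmf n x) G)
      (measure_pmf.expectation (empirical_pmf n x) (\<lambda>y. G y * G y)) (1 / real n)"
  proof unfold_locales
    show "n \<ge> 3" by fact
    show "prob_space.indep_vars (measure_pmf ?B) (\<lambda>_. borel) (\<lambda>i f. f i :: real) {1..n}" by (rule ind)
    fix i j assume ij: "i \<in> {1..n}" "j \<in> {1..n}" "i \<noteq> j"
    show "\<bar>measure_pmf.prob ?B {f \<in> space ?B. f i < f j} - measure_pmf.expectation (empirical_pmf n x) G\<bar> \<le> 1 / real n"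
      using measure_pmf.prob_greater[OF ind ij] ij by (simp add: survival expectation)
    have atom: "measure_pmf.prob ?B {f \<in> space ?B. f j = y} \<le> 1 / real n" for y
      using prob_empirical_atom_le[OF inj, of y] n ij
      unfolding map_bootstrap_pmf_component[OF ij(2), of x, symmetric]
      by (simp add: vimage_def)
    show "measure_pmf.prob ?B {f \<in> space ?B. f i = f j} \<le> 1 / real n"
      by (rule measure_pmf.prob_tie_le[OF ind ij atom])
  next
    fix i j k assume ijk: "i \<in> {1..n}" "j \<in> {1..n}" "k \<in> {1..n}" "i \<noteq> j" "i \<noteq> k" "j \<noteq> k"
    show "\<bar>measure_pmf.prob ?B {f \<in> space ?B. f i < f j \<and> f i < f k}
        - measure_pmf.expectation (empirical_pmf n x) (\<lambda>y. G y * G y)\<bar> \<le> 1 / real n"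
      using measure_pmf.prob_both_greater[OF ind ijk] ijk expectation[of i "\<lambda>y. G y * G y"] by (simp add: survival)
  qed
  then show ?thesis by blast
qed

lemma bootstrap_variance_U_AP_approx:
  assumes "inj_on x {1..n}" "n \<ge> 3"
  shows "\<bar>(real n - 1) * bootstrap_variance n x (U_AP n) - 1 / 12\<bar>
     \<le> 80 / real n + 2 * harm (n - 1) / (real n - 1)"
proof -
  obtain \<theta> \<eta>2 where "nearly_exchangeable (measure_pmf (bootstrap_pmf n x)) (\<lambda>i f. f i) n \<theta> \<eta>2 (1 / real n)"
    using bootstrap_nearly_exchangeable[OF assms] by blast
  from nearly_exchangeable.variance_U_AP_approx[OF this] show ?thesis
    by (simp add: bootstrap_variance_def)
qed

section \<open>The data and the limit\<close>

lemma harm_over_n_tendsto_0: "(\<lambda>n. 2 * harm (n - 1) / (real n - 1)) \<longlonglongrightarrow> 0"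
proof -
  obtain g :: real where g: "(\<lambda>n. harm n - ln (real n)) \<longlonglongrightarrow> g"
    using euler_mascheroni_convergent by (auto simp: convergent_def)
  have "(\<lambda>n. 2 * ((harm n - ln (real n)) * (1 / real n) + ln (real n) / real n)) \<longlonglongrightarrow> 2 * (g * 0 + 0)"
    by (intro tendsto_intros g)
  then have "(\<lambda>n. 2 * harm n / real n) \<longlonglongrightarrow> 0"
    by (simp add: diff_divide_distrib)
  from filterlim_compose[OF this filterlim_minus_const_nat_at_top[of 1]]
  have "(\<lambda>n. 2 * harm (n - 1) / real (n - 1)) \<longlonglongrightarrow> (0 :: real)" .
  then show ?thesis
    by (rule Lim_transform_eventually) (auto intro!: eventually_mono[OF eventually_ge_at_top[of 1]] simp: of_nat_diff)
qed

lemma (in prob_space) prob_atom_eq_0: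
  assumes [measurable]: "random_variable borel Z" and ac: "absolutely_continuous lborel (distr M borel Z)"
  shows "prob {\<omega> \<in> space M. Z \<omega> = (y :: real)} = 0"
proof -
  have "{y} \<in> null_sets (distr M borel Z)"
    using ac unfolding absolutely_continuous_def by (rule subsetD) (simp add: null_sets_def)
  then have "emeasure M (Z -` {y} \<inter> space M) = 0"
    by (simp add: null_sets_def emeasure_distr)
  then show ?thesis
    by (simp add: emeasure_eq_measure vimage_def Int_def conj_commute)
qed

lemma (in prob_space) AE_inj_on:
  fixes Y :: "nat \<Rightarrow> 'a \<Rightarrow> real"
  assumes rv: "\<And>i. i \<in> I \<Longrightarrow> random_variable borel (Y i)" and "finite I"
    and tie: "\<And>i j. i \<in> I \<Longrightarrow> j \<in> I \<Longrightarrow> i \<noteq> j \<Longrightarrow> prob {\<omega> \<in> space M. Y i \<omega> = Y j \<omega>} = 0"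
  shows "AE \<omega> in M. inj_on (\<lambda>i. Y i \<omega>) I"
proof -
  have "AE \<omega> in M. Y i \<omega> = Y j \<omega> \<longrightarrow> i = j" if ij: "i \<in> I" "j \<in> I" for i j
  proof (cases "i = j")
    case False
    have [measurable]: "random_variable borel (Y i)" "random_variable borel (Y j)"
      using rv ij by auto
    show ?thesis
      using tie[OF ij False] by (intro AE_I[of _ _ "{\<omega> \<in> space M. Y i \<omega> = Y j \<omega>}"]) (auto simp: emeasure_eq_measure)
  qed auto
  then have "AE \<omega> in M. \<forall>i\<in>I. \<forall>j\<in>I. Y i \<omega> = Y j \<omega> \<longrightarrow> i = j"
    using \<open>finite I\<close> by (simp add: AE_finite_all)
  then show ?thesis by (simp add: inj_on_def)
qed

text \<open>The exceptional event consists of the samples with a tie and is null; outside of it the two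
  normalised variances differ by at most a deterministic null sequence.\<close>

theorem corollary3p3:
  fixes M :: "nat \<Rightarrow> 'a measure"
    and X :: "nat \<Rightarrow> nat \<Rightarrow> 'a \<Rightarrow> real"
    and \<delta> p \<sigma> :: "nat \<Rightarrow> real"
    and \<theta> \<eta> :: real
  assumes prob: "\<And>n. n \<ge> 1 \<Longrightarrow> prob_space (M n)"
    and indep: "\<And>n. n \<ge> 1 \<Longrightarrow> prob_space.indep_vars (M n) (\<lambda>_. borel) (X n) {1..n}"
    and abs_cont: "\<And>n i. n \<ge> 1 \<Longrightarrow> i \<in> {1..n} \<Longrightarrow>
          absolutely_continuous lborel (distr (M n) borel (X n i))"
    and \<delta>_range: "\<And>n. n \<ge> 1 \<Longrightarrow> \<delta> n \<in> {0<..<1}"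
    and p_range: "\<And>n. n \<ge> 1 \<Longrightarrow> p n \<in> {0<..<1}"
    and gap: "\<forall>\<^sub>F n in sequentially. \<forall>i\<in>{1..n}.
          measure (M n) {\<omega> \<in> space (M n). \<forall>j\<in>{1..n} - {i}.
             cond_prob_gt (M n) (X n) j i \<omega> - prob_gt (M n) (X n) j i \<in> {\<delta> n..1}} \<ge> p n \<or>
          measure (M n) {\<omega> \<in> space (M n). \<forall>j\<in>{1..n} - {i}.
             cond_prob_gt (M n) (X n) j i \<omega> - prob_gt (M n) (X n) j i \<in> {-1..- \<delta> n}} \<ge> p n"
    and rate: "strictly_gtrsim (\<lambda>n. \<delta> n ^ 3 * p n)
          (\<lambda>n. real n powr (- 1 / 3) * (ln (real n))\<^sup>2)"
    and \<theta>_pos: "\<theta> > 0"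
    and \<theta>_approx: "\<exists>C>0. \<forall>n\<ge>1. \<forall>i\<in>{1..n}. \<forall>j\<in>{1..n}. i \<noteq> j \<longrightarrow>
          \<bar>prob_gt (M n) (X n) i j - \<theta>\<bar> \<le> C * real n powr (- 1 / 6) * ln (real n)"
    and \<eta>_pos: "\<eta>\<^sup>2 > 0"
    and \<eta>_approx: "\<exists>C>0. \<forall>n\<ge>1. \<forall>i\<in>{1..n}. \<forall>j\<in>{1..n} - {i}. \<forall>k\<in>{1..n} - {i}.
          \<bar>prob_space.expectation (M n)
              (\<lambda>\<omega>. cond_prob_gt (M n) (X n) j i \<omega> * cond_prob_gt (M n) (X n) k i \<omega>) - \<eta>\<^sup>2\<bar>
            \<le> C * real n powr (- 1 / 3) * (ln (real n))\<^sup>2"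
    and \<eta>_neq_\<theta>: "\<eta>\<^sup>2 \<noteq> \<theta>\<^sup>2"
    and \<sigma>_def: "\<And>n. n \<ge> 1 \<Longrightarrow>
          \<sigma> n = sqrt (prob_space.variance (M n) (\<lambda>\<omega>. U_AP n (\<lambda>i. X n i \<omega>)))"
  shows "conv_in_prob_zero M (\<lambda>n \<omega>.
           \<bar>bootstrap_variance n (\<lambda>i. X n i \<omega>) (\<lambda>x. inverse (\<sigma> n) * U_AP n x)
            - prob_space.variance (M n) (\<lambda>\<omega>'. inverse (\<sigma> n) * U_AP n (\<lambda>i. X n i \<omega>'))\<bar>)"
proof -
  obtain C1 where C1: "C1 > 0" and pair: "\<And>n i j. n \<ge> 1 \<Longrightarrow> i \<in> {1..n} \<Longrightarrow> j \<in> {1..n} \<Longrightarrow> i \<noteq> j \<Longrightarrow>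
      \<bar>prob_gt (M n) (X n) i j - \<theta>\<bar> \<le> C1 * real n powr (- 1 / 6) * ln (real n)"
    using \<theta>_approx by blast
  obtain C2 where C2: "C2 > 0" and triple: "\<And>n i j k. n \<ge> 1 \<Longrightarrow> i \<in> {1..n} \<Longrightarrow> j \<in> {1..n} - {i} \<Longrightarrow> k \<in> {1..n} - {i} \<Longrightarrow>
      \<bar>prob_space.expectation (M n)
              (\<lambda>\<omega>. cond_prob_gt (M n) (X n) j i \<omega> * cond_prob_gt (M n) (X n) k i \<omega>) - \<eta>\<^sup>2\<bar>
            \<le> C2 * real n powr (- 1 / 3) * (ln (real n))\<^sup>2"
    using \<eta>_approx by blast
  define e where "e n = C1 * real n powr (- 1 / 6) * ln (real n) + C2 * real n powr (- 1 / 3) * (ln (real n))\<^sup>2" for n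
  define h where "h n = 2 * harm (n - 1) / (real n - 1)" for n
  define V where "V n = prob_space.variance (M n) (\<lambda>\<omega>. U_AP n (\<lambda>i. X n i \<omega>))" for n
  have tie: "measure (M n) {\<omega> \<in> space (M n). X n i \<omega> = X n j \<omega>} = 0"
    if "n \<ge> 1" "i \<in> {1..n}" "j \<in> {1..n}" "i \<noteq> j" for n i j
  proof -
    interpret prob_space "M n" using prob that by auto
    have "prob {\<omega> \<in> space (M n). X n j \<omega> = y} \<le> 0" for y
      using prob_atom_eq_0[of "X n j" y] indep_vars_rv[OF indep] abs_cont that by simp
    from prob_tie_le[OF indep[OF that(1)] that(2-4) this] show ?thesis
      by (simp add: measure_le_0_iff)
  qed
  have V_approx: "\<bar>(real n - 1) * V n - 1 / 12\<bar> \<le> 80 * e n + h n" if n: "n \<ge> 3" for n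
  proof -
    interpret prob_space "M n" using prob n by auto
    have e1: "C1 * real n powr (- 1 / 6) * ln (real n) \<le> e n"
      and e2: "C2 * real n powr (- 1 / 3) * (ln (real n))\<^sup>2 \<le> e n"
      and e0: "0 \<le> e n"
      using C1 C2 n by (auto simp: e_def)
    interpret nearly_exchangeable "M n" "X n" n \<theta> "\<eta>\<^sup>2" "e n"
    proof unfold_locales
      show "indep_vars (\<lambda>_. borel) (X n) {1..n}" using indep n by simp
      show "3 \<le> n" by fact
      fix i j assume ij: "i \<in> {1..n}" "j \<in> {1..n}" "i \<noteq> j"
      show "\<bar>prob {\<omega> \<in> space (M n). X n i \<omega> < X n j \<omega>} - \<theta>\<bar> \<le> e n"
        using pair[of n j i] e1 ij n by (simp add: prob_gt_def)
      show "prob {\<omega> \<in> space (M n). X n i \<omega> = X n j \<omega>} \<le> e n"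
        using tie[of n i j] e0 ij n by simp
    next
      fix i j k assume ijk: "i \<in> {1..n}" "j \<in> {1..n}" "k \<in> {1..n}" "i \<noteq> j" "i \<noteq> k" "j \<noteq> k"
      show "\<bar>prob {\<omega> \<in> space (M n). X n i \<omega> < X n j \<omega> \<and> X n i \<omega> < X n k \<omega>} - \<eta>\<^sup>2\<bar> \<le> e n"
        using triple[of n i j k] e2 ijk n expectation_cond_prob_gt_product[OF indep ijk] by simp
    qed
    show ?thesis
      using variance_U_AP_approx by (simp add: V_def h_def)
  qed
  have lim: "(\<lambda>n. 24 * (80 / real n + h n + (80 * e n + h n))) \<longlonglongrightarrow> 0"
  proof -
    have "e \<longlonglongrightarrow> 0"
      unfolding e_def by real_asymp
    moreover have "h \<longlonglongrightarrow> 0"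
      unfolding h_def by (rule harm_over_n_tendsto_0)
    moreover have "(\<lambda>n. 80 / real n) \<longlonglongrightarrow> 0"
      by real_asymp
    ultimately have "(\<lambda>n. 24 * (80 / real n + h n + (80 * e n + h n))) \<longlonglongrightarrow> 24 * (0 + 0 + (80 * 0 + 0))"
      by (intro tendsto_intros)
    then show ?thesis by simp
  qed
  show ?thesis
    unfolding conv_in_prob_zero_def
  proof (intro allI impI)
    fix \<epsilon> :: real assume "\<epsilon> > 0"
    \<comment> \<open>The bound $1$ keeps $(n-1) V_n$ above $1/24$, half of its limit, so that dividing by it costs a
      factor of $24$.\<close>
    then have "\<forall>\<^sub>F n in sequentially. 24 * (80 / real n + h n + (80 * e n + h n)) < min \<epsilon> 1"
      by (intro order_tendstoD(2)[OF lim]) auto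
    then have "\<forall>\<^sub>F n in sequentially. measure (M n) {\<omega> \<in> space (M n).
        \<bar>\<bar>bootstrap_variance n (\<lambda>i. X n i \<omega>) (\<lambda>x. inverse (\<sigma> n) * U_AP n x)
            - prob_space.variance (M n) (\<lambda>\<omega>'. inverse (\<sigma> n) * U_AP n (\<lambda>i. X n i \<omega>'))\<bar>\<bar> > \<epsilon>} = 0"
      using eventually_ge_at_top[of 3]
    proof eventually_elim
      case (elim n)
      interpret prob_space "M n" using prob elim by auto
      have rn: "real n - 1 > 0" using elim by simp
      have nonneg: "0 \<le> 80 / real n" "0 \<le> h n" using elim by (auto simp: h_def harm_nonneg)
      have le_1: "24 * (80 / real n + h n + (80 * e n + h n)) < 1" using elim by simp
      have Vn: "\<bar>(real n - 1) * V n - 1 / 12\<bar> \<le> 80 * e n + h n"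
        using V_approx elim by simp
      have "1 / 24 \<le> 1 / 12 - (80 * e n + h n)"
        using le_1 nonneg by argo
      also have "\<dots> \<le> (real n - 1) * V n"
        using Vn by (simp only: abs_diff_le_iff)
      finally have lower: "1 / 24 \<le> (real n - 1) * V n" .
      then have V_pos: "V n > 0"
        using rn by (metis less_le_trans zero_less_divide_1_iff zero_less_mult_pos zero_less_numeral)
      have \<sigma>: "(inverse (\<sigma> n))\<^sup>2 = inverse (V n)"
        using \<sigma>_def[of n] elim V_pos by (simp add: V_def power_inverse)
      have small: "\<bar>bootstrap_variance n x (\<lambda>x. inverse (\<sigma> n) * U_AP n x)
            - variance (\<lambda>\<omega>'. inverse (\<sigma> n) * U_AP n (\<lambda>i. X n i \<omega>'))\<bar> \<le> \<epsilon>" if "inj_on x {1..n}" for x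
      proof -
        define b where "b = bootstrap_variance n x (U_AP n)"
        have "\<bar>(real n - 1) * b - 1 / 12\<bar> \<le> 80 / real n + h n"
          using bootstrap_variance_U_AP_approx[OF that] elim by (simp add: b_def h_def)
        then have "\<bar>(real n - 1) * b - (real n - 1) * V n\<bar> \<le> 80 / real n + h n + (80 * e n + h n)"
          using Vn by linarith
        also have "\<dots> \<le> \<epsilon> * (1 / 24)"
          using elim by simp
        also have "\<dots> \<le> \<epsilon> * ((real n - 1) * V n)"
          using lower \<open>\<epsilon> > 0\<close> by (intro mult_left_mono) auto
        finally have "(real n - 1) * \<bar>b - V n\<bar> \<le> (real n - 1) * (\<epsilon> * V n)"
          unfolding right_diff_distrib[symmetric] abs_mult using rn by (simp only: abs_of_pos mult_ac)
        then have "\<bar>b - V n\<bar> \<le> \<epsilon> * V n"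
          by (rule mult_left_le_imp_le) (rule rn)
        moreover have "bootstrap_variance n x (\<lambda>x. inverse (\<sigma> n) * U_AP n x) = inverse (V n) * b"
          unfolding b_def bootstrap_variance_def measure_pmf.variance_mult_left \<sigma> ..
        moreover have "variance (\<lambda>\<omega>'. inverse (\<sigma> n) * U_AP n (\<lambda>i. X n i \<omega>')) = inverse (V n) * V n"
          unfolding variance_mult_left \<sigma> V_def ..
        moreover have "\<bar>inverse (V n) * b - inverse (V n) * V n\<bar> = \<bar>b - V n\<bar> / V n"
          unfolding right_diff_distrib[symmetric] abs_mult using V_pos by (simp add: divide_inverse mult.commute)
        ultimately show ?thesis
          using V_pos by (simp only: pos_divide_le_eq)
      qed
      have "AE \<omega> in M n. inj_on (\<lambda>i. X n i \<omega>) {1..n}"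
        using tie elim by (intro AE_inj_on) (auto intro: indep_vars_rv[OF indep])
      then have "measure (M n) {\<omega> \<in> space (M n).
        \<bar>\<bar>bootstrap_variance n (\<lambda>i. X n i \<omega>) (\<lambda>x. inverse (\<sigma> n) * U_AP n x)
            - variance (\<lambda>\<omega>'. inverse (\<sigma> n) * U_AP n (\<lambda>i. X n i \<omega>'))\<bar>\<bar> > \<epsilon>} \<le> measure (M n) {}"
        using small by (intro finite_measure_mono_AE) (auto simp: not_less[symmetric])
      then show ?case by (simp add: measure_le_0_iff)
    qed
    then show "(\<lambda>n. measure (M n) {\<omega> \<in> space (M n).
        \<bar>\<bar>bootstrap_variance n (\<lambda>i. X n i \<omega>) (\<lambda>x. inverse (\<sigma> n) * U_AP n x)
            - prob_space.variance (M n) (\<lambda>\<omega>'. inverse (\<sigma> n) * U_AP n (\<lambda>i. X n i \<omega>'))\<bar>\<bar> > \<epsilon>}) \<longlonglongrightarrow> 0"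
      by (rule tendsto_eventually)
  qed
qed

end
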